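(* Let $0\le l<n$, let $\tilde C$ be an arbitrary $(n-l)\times(n-l)$ matrix, and let $$Z=\begin{pmatrix}-R_1^U(\hat BR_1^U)^{-1}\hat BR_1^S+R_1^S-F^{-1}R_1^S\tilde C\\ \tilde C\end{pmatrix},$$ a $(2n-l)\times(n-l)$ matrix. Then: (i) $Z$ has full column rank $n-l$; (ii) there exists a full-rank $n\times(2n-l)$ matrix $\bar B$ with $\bar BZ=0$ (so that, writing $\bar B=(B_u,B_pR_1^S)$ with $n\times n$ matrices $B_u,B_p$, one obtains a boundary matrix $B=(B_u,B_p)$); (iii) such $\bar B$ is unique up to multiplication by an invertible matrix: if $\bar B_1,\bar B_2$ are full-rank $n\times(2n-l)$ matrices with $\bar B_1Z=\bar B_2Z=0$, then $\bar B_2=X\bar B_1$ for some invertible $n\times n$ matrix $X$.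
   Context: $F$ is a real invertible $n\times n$ matrix and $T$ an invertible matrix with $T^{-1}FT=\mathrm{diag}(\lambda_1,\dots,\lambda_n)$, $\lambda_1,\dots,\lambda_l>0$ and $\lambda_{l+1},\dots,\lambda_n<0$. $T=(R_1^U,R_1^S)$, where $R_1^U$ consists of the first $l$ columns and $R_1^S$ of the last $n-l$ columns. $\hat B$ is an $l\times n$ matrix such that $\hat BR_1^U$ is invertible. *)

theory Defs
  imports Complex_Main
    "Jordan_Normal_Form.Matrix"
    "Jordan_Normal_Form.Gauss_Jordan_Elimination"
    "Jordan_Normal_Form.DL_Rank"
begin

(* Carrier-based matrices are used because blocks of width l = 0 must be allowed. *)

definition append_cols :: "'a :: zero mat \<Rightarrow> 'a mat \<Rightarrow> 'a mat" (infixr "@\<^sub>c" 65) where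
  "A @\<^sub>c B = four_block_mat A B (0\<^sub>m 0 (dim_col A)) (0\<^sub>m 0 (dim_col B))"

(* Meaningful only for invertible A; for singular A the value is unspecified. *)
definition mat_inv :: "'a :: field mat \<Rightarrow> 'a mat" where
  "mat_inv A = the (mat_inverse A)"

end

theory Submission
  imports Defs
begin

text \<open>
  Everything is reduced to one-sided inverses. Put \<open>k = n - l\<close>, \<open>H = (B_hat R_U)^{-1} B_hat\<close> and
  \<open>M = F^{-1} R_S\<close>, and let \<open>L\<close> consist of the last \<open>k\<close> rows of \<open>T^{-1}\<close>, so that \<open>L R_U = 0\<close>,
  \<open>L R_S = 1\<close> and \<open>H R_U = 1\<close>. The matrix \<open>A = R_S - R_U H R_S\<close> is \<open>R_S\<close> projected along the range
  of \<open>R_U\<close> onto the kernel of \<open>B_hat\<close>; hence \<open>H A = 0\<close> and \<open>L A = 1\<close>. The matrix in question is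
  \<open>A - M C\<close> stacked on \<open>C\<close>, that is, \<open>A\<close> stacked on \<open>C\<close> after the shear that subtracts \<open>M\<close> times
  the lower block from the upper one.

  Undoing the shear makes the rest explicit. The block row \<open>(L, L M)\<close> is a left inverse of \<open>Z\<close>
  (\<open>sheared_left_inverse\<close>), which gives full column rank. The rows \<open>(H, H M)\<close> and
  \<open>(- C L, 1 - C L M)\<close> annihilate \<open>Z\<close> (\<open>sheared_annihilator\<close>) and together have a right inverse
  (\<open>sheared_annihilator_right_inverse\<close>), so they form a boundary matrix of full rank. Its right block
  \<open>N\<close> has the form \<open>B_p R_S\<close> with \<open>B_p = N L\<close>.

  For uniqueness, \<open>Z\<close> has rank \<open>k\<close> in a space of dimension \<open>n + k\<close>, so its left annihilator has
  dimension \<open>n\<close> and is the row space of any full-rank \<open>n\<close>-row annihilator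
  (\<open>full_rank_annihilator_factors\<close>). Two such matrices therefore factor through each other.
\<close>

section \<open>Full rank and one-sided inverses\<close>

text \<open>
  A maximal independent set of columns has \<open>n\<close> elements, hence is a basis of the whole space, so the
  columns of the right inverse can be chosen as preimages of the unit vectors.
\<close>

lemma (in vec_space) rank_full_rows_imp_right_inverse:
  assumes A: "A \<in> carrier_mat n m" and r: "rank A = n"
  obtains E where "E \<in> carrier_mat m n" "A * E = 1\<^sub>m n"
proof -
  let ?P = "\<lambda>S. S \<subseteq> set (cols A) \<and> lin_indpt S"
  have cA: "set (cols A) \<subseteq> carrier_vec n"
    using A cols_dim by blast
  have "lin_indpt {}"
    using fin_dim finite_basis_exists subset_li_is_li basis_def by blast
  then obtain S where S: "maximal S ?P" "finite S"
    using maximal_exists_superset[of "set (cols A)" ?P "{}"] by auto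
  have "S \<subseteq> set (cols A)" "lin_indpt S" using S(1) unfolding maximal_def by auto
  have "card S = n" using rank_card_indpt[OF A S(1)] r by simp
  then have "basis S"
    using dim_li_is_basis[OF fin_dim S(2)] \<open>S \<subseteq> set (cols A)\<close> cA \<open>lin_indpt S\<close> dim_is_n by auto
  then have "carrier_vec n \<subseteq> span (set (cols A))"
    using span_is_monotone[OF \<open>S \<subseteq> set (cols A)\<close>] unfolding basis_def by auto
  then have "\<exists>x \<in> carrier_vec m. A *\<^sub>v x = unit_vec n j" for j
    using col_space_eq[OF A] A unfolding col_space_def by (fastforce dest: subsetD[of "carrier_vec n" _ "unit_vec n j"])
  then obtain x where x: "\<And>j. x j \<in> carrier_vec m" "\<And>j. A *\<^sub>v x j = unit_vec n j"
    by metis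
  define E where "E = mat_of_cols m (map x [0..<n])"
  have E: "E \<in> carrier_mat m n" unfolding E_def by auto
  have "A * E = 1\<^sub>m n"
  proof (rule mat_col_eqI)
    fix j assume "j < dim_col (1\<^sub>m n :: 'a mat)"
    then have j: "j < n" by simp
    have "col E j = x j" unfolding E_def using x(1) j by simp
    then show "col (A * E) j = col (1\<^sub>m n) j" using x(2) col_mult2[OF A E j] j by simp
  qed (use A E in auto)
  with E that show ?thesis by blast
qed

lemma (in vec_space) rank_eq_if_right_inverse:
  assumes A: "A \<in> carrier_mat n m" and E: "E \<in> carrier_mat m n" and AE: "A * E = 1\<^sub>m n"
  shows "rank A = n"
proof -
  have "v \<in> col_space A" if v: "v \<in> carrier_vec n" for v
  proof -
    have "A *\<^sub>v (E *\<^sub>v v) = v"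
      using assoc_mult_mat_vec[OF A E v] AE v by simp
    moreover have "E *\<^sub>v v \<in> carrier_vec m" using E v by auto
    ultimately show ?thesis using col_space_eq[OF A] A v by auto
  qed
  moreover have "col_space A \<subseteq> carrier_vec n"
    using col_space_eq[OF A] A by auto
  ultimately have "span (set (cols A)) = carrier_vec n" unfolding col_space_def by blast
  then have "span_vs (set (cols A)) = V" by simp
  then show ?thesis unfolding rank_def using dim_is_n by simp
qed

text \<open>
  Besides excluding nontrivial relations between the columns, the left inverse must separate equal
  columns: the rank is the dimension of the span of the \<^emph>\<open>set\<close> of columns.
\<close>

lemma (in vec_space) rank_eq_if_left_inverse:
  assumes A: "A \<in> carrier_mat n m" and Y: "Y \<in> carrier_mat m n" and YA: "Y * A = 1\<^sub>m m"
  shows "rank A = m"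
proof (rule lin_indpt_full_rank[OF A])
  have inj: "v = 0\<^sub>v m" if v: "v \<in> carrier_vec m" and "A *\<^sub>v v = 0\<^sub>v n" for v
  proof -
    have "v = Y *\<^sub>v (A *\<^sub>v v)" using assoc_mult_mat_vec[OF Y A v] YA v by simp
    then show ?thesis using that Y by (auto simp: mult_mat_vec_def)
  qed
  have colY: "Y *\<^sub>v col A i = unit_vec m i" if "i < m" for i
    using col_mult2[OF Y A that] YA that by simp
  show d: "distinct (cols A)"
  proof (unfold distinct_conv_nth, intro allI impI)
    fix i j assume "i < length (cols A)" "j < length (cols A)" "i \<noteq> j"
    then show "cols A ! i \<noteq> cols A ! j"
      using colY[of i] colY[of j] A unit_vec_eq[of i m j] by auto
  qed
  show "lin_indpt (set (cols A))"
    using lin_depE[OF A _ d] inj by metis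
qed

section \<open>Block matrices\<close>

lemma carrier_append_cols [simp, intro]:
  "A \<in> carrier_mat r a \<Longrightarrow> B \<in> carrier_mat r b \<Longrightarrow> A @\<^sub>c B \<in> carrier_mat r (a + b)"
  unfolding append_cols_def by auto

lemma append_cols_inject:
  assumes "A \<in> carrier_mat r a" "B \<in> carrier_mat r b" "A' \<in> carrier_mat r a" "B' \<in> carrier_mat r b"
    and eq: "A @\<^sub>c B = A' @\<^sub>c B'"
  shows "A = A'" "B = B'"
proof -
  have *: "(A @\<^sub>c B) $$ (i, j) = (A' @\<^sub>c B') $$ (i, j)" for i j using eq by simp
  show "A = A'"
  proof (rule eq_matI)
    fix i j assume "i < dim_row A'" "j < dim_col A'"
    then show "A $$ (i, j) = A' $$ (i, j)"
      using *[of i j] assms(1-4) by (auto simp: append_cols_def)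
  qed (use assms(1-4) in auto)
  show "B = B'"
  proof (rule eq_matI)
    fix i j assume "i < dim_row B'" "j < dim_col B'"
    then show "B $$ (i, j) = B' $$ (i, j)"
      using *[of i "j + a"] assms(1-4) by (auto simp: append_cols_def)
  qed (use assms(1-4) in auto)
qed

text \<open>
  The factors are four-block matrices with empty blocks of height or width \<open>0\<close>; these drop out of
  the product.
\<close>

lemma append_cols_mult_append_rows:
  fixes A B C D :: "'a :: semiring_0 mat"
  assumes "A \<in> carrier_mat r a" "B \<in> carrier_mat r b" "C \<in> carrier_mat a c" "D \<in> carrier_mat b c"
  shows "(A @\<^sub>c B) * (C @\<^sub>r D) = A * C + B * D"
proof -
  have "(A @\<^sub>c B) * (C @\<^sub>r D)
    = four_block_mat (A * C + B * D) (A * 0\<^sub>m a 0 + B * 0\<^sub>m b 0)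
        (0\<^sub>m 0 a * C + 0\<^sub>m 0 b * D) (0\<^sub>m 0 a * 0\<^sub>m a 0 + 0\<^sub>m 0 b * 0\<^sub>m b 0)"
    unfolding append_cols_def append_rows_def
    using assms by (subst mult_four_block_mat[of _ r a _ b _ 0 _ _ c _ 0]) auto
  also have "\<dots> = A * C + B * D"
    using assms by (intro eq_matI) auto
  finally show ?thesis .
qed

lemma append_rows_mult:
  fixes A B C :: "'a :: semiring_0 mat"
  assumes "A \<in> carrier_mat a n" "B \<in> carrier_mat b n" "C \<in> carrier_mat n c"
  shows "(A @\<^sub>r B) * C = (A * C) @\<^sub>r (B * C)"
  using assms by (intro eq_matI)
    (auto simp: append_rows_def scalar_prod_def row_def intro!: sum.cong)

lemma mult_append_cols:
  fixes A B C :: "'a :: semiring_0 mat"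
  assumes "A \<in> carrier_mat a n" "B \<in> carrier_mat n b" "C \<in> carrier_mat n c"
  shows "A * (B @\<^sub>c C) = (A * B) @\<^sub>c (A * C)"
  using assms by (intro eq_matI)
    (auto simp: append_cols_def scalar_prod_def row_def intro!: sum.cong)

lemma append_rows_append_cols_interchange:
  assumes "A \<in> carrier_mat r a" "B \<in> carrier_mat r b" "C \<in> carrier_mat s a" "D \<in> carrier_mat s b"
  shows "(A @\<^sub>c B) @\<^sub>r (C @\<^sub>c D) = (A @\<^sub>r C) @\<^sub>c (B @\<^sub>r D)"
  using assms by (intro eq_matI) (auto simp: append_rows_def append_cols_def)

lemma one_mat_blocks:
  "(1\<^sub>m a @\<^sub>c 0\<^sub>m a b) @\<^sub>r (0\<^sub>m b a @\<^sub>c 1\<^sub>m b) = 1\<^sub>m (a + b)"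
  by (intro eq_matI) (auto simp: append_rows_def append_cols_def)

lemma zero_append_rows: "0\<^sub>m a c @\<^sub>r 0\<^sub>m b c = 0\<^sub>m (a + b) c"
  by (intro eq_matI) (auto simp: append_rows_def)

lemma mat_inv_invertible:
  assumes A: "A \<in> carrier_mat n n" and "invertible_mat A"
  shows "mat_inv A \<in> carrier_mat n n" "A * mat_inv A = 1\<^sub>m n" "mat_inv A * A = 1\<^sub>m n"
proof -
  obtain B where B: "A * B = 1\<^sub>m n" "B * A = 1\<^sub>m (dim_row B)"
    using assms unfolding invertible_mat_def inverts_mat_def by auto
  have "dim_row B = n" "dim_col B = n"
    using A B by (metis carrier_matD(2) index_mult_mat(3) index_one_mat(3))
      (metis B(1) index_mult_mat(3) index_one_mat(3))
  with B A have "A \<in> Units (ring_mat TYPE('a) n ())"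
    unfolding Units_def by (auto simp: ring_mat_def intro!: bexI[of _ B])
  then obtain B' where "mat_inverse A = Some B'"
    using mat_inverse(1)[OF A, where b = "()"] by (cases "mat_inverse A") auto
  with mat_inverse(2)[OF A this]
  show "mat_inv A \<in> carrier_mat n n" "A * mat_inv A = 1\<^sub>m n" "mat_inv A * A = 1\<^sub>m n"
    unfolding mat_inv_def by auto
qed

lemma invertible_if_right_inverse:
  fixes X :: "'a :: field mat"
  assumes "X \<in> carrier_mat n n" "W \<in> carrier_mat n n" "X * W = 1\<^sub>m n"
  shows "invertible_mat X"
  using assms mat_mult_left_right_inverse[OF assms]
  unfolding invertible_mat_def inverts_mat_def by auto

section \<open>The left annihilator of a matrix of full column rank\<close>

text \<open>
  After correcting \<open>Y\<close> to a left inverse \<open>Y'\<close> of \<open>Z\<close> that also kills \<open>E\<close>, the square matrices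
  \<open>B @\<^sub>r Y'\<close> and \<open>E @\<^sub>c Z\<close> are inverse to each other, so \<open>E B + Z Y' = 1\<close>. Multiplying by \<open>B'\<close> from
  the left removes the second summand.
\<close>

lemma full_rank_annihilator_factors:
  fixes Z B B' :: "'a :: field mat"
  assumes Z: "Z \<in> carrier_mat (n + k) k" and Y: "Y \<in> carrier_mat k (n + k)" and YZ: "Y * Z = 1\<^sub>m k"
    and B: "B \<in> carrier_mat n (n + k)" and E: "E \<in> carrier_mat (n + k) n" and BE: "B * E = 1\<^sub>m n"
    and BZ: "B * Z = 0\<^sub>m n k"
    and B': "B' \<in> carrier_mat m (n + k)" and B'Z: "B' * Z = 0\<^sub>m m k"
  shows "B' = B' * E * B"
proof -
  define Y' where "Y' = Y - Y * E * B"
  have Y': "Y' \<in> carrier_mat k (n + k)" unfolding Y'_def using Y E B by auto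
  have YE: "Y * E \<in> carrier_mat k n" using Y E by auto
  have "Y' * Z = Y * Z - Y * E * (B * Z)"
    unfolding Y'_def using minus_mult_distrib_mat[OF Y _ Z, of "Y * E * B"] assoc_mult_mat[OF YE B Z] YE B
    by (simp del: assoc_mult_mat)
  then have Y'Z: "Y' * Z = 1\<^sub>m k" using YZ BZ right_mult_zero_mat[OF YE] by (intro eq_matI) auto
  have "Y' * E = Y * E - Y * E * (B * E)"
    unfolding Y'_def using minus_mult_distrib_mat[OF Y _ E, of "Y * E * B"] assoc_mult_mat[OF YE B E] YE B
    by (simp del: assoc_mult_mat)
  then have Y'E: "Y' * E = 0\<^sub>m k n" using BE right_mult_one_mat[OF YE] minus_r_inv_mat[OF YE] by metis
  \<comment> \<open>The dimensions \<open>n\<close> and \<open>k\<close> add up: the block matrices are square, so it suffices to compute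
    their product in the easy order.\<close>
  have "(B @\<^sub>r Y') * (E @\<^sub>c Z) = (B * (E @\<^sub>c Z)) @\<^sub>r (Y' * (E @\<^sub>c Z))"
    by (rule append_rows_mult[OF B Y']) (use E Z in auto)
  also have "\<dots> = (1\<^sub>m n @\<^sub>c 0\<^sub>m n k) @\<^sub>r (0\<^sub>m k n @\<^sub>c 1\<^sub>m k)"
    by (simp add: mult_append_cols[OF B E Z] mult_append_cols[OF Y' E Z] BE BZ Y'E Y'Z)
  also have "\<dots> = 1\<^sub>m (n + k)" by (rule one_mat_blocks)
  finally have "(E @\<^sub>c Z) * (B @\<^sub>r Y') = 1\<^sub>m (n + k)"
    by (rule mat_mult_left_right_inverse[of _ "n + k", rotated 2])
      (use carrier_append_rows[OF B Y'] carrier_append_cols[OF E Z] in auto)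
  then have one: "E * B + Z * Y' = 1\<^sub>m (n + k)"
    using append_cols_mult_append_rows[OF E Z B Y'] by simp
  have "B' = B' * (E * B + Z * Y')" using one B' by simp
  also have "\<dots> = B' * (E * B) + B' * (Z * Y')"
    by (rule mult_add_distrib_mat[OF B']) (use E B Z Y' in auto)
  also have "B' * (Z * Y') = 0\<^sub>m m (n + k)"
    using assoc_mult_mat[OF B' Z Y'] B'Z Y' by simp
  also have "B' * (E * B) = B' * E * B" using assoc_mult_mat[OF B' E B] by simp
  finally show ?thesis using B' E B by simp
qed

text \<open>
  With \<open>B2 = X B1\<close>, a right inverse \<open>E2\<close> of \<open>B2\<close> turns into the right inverse \<open>B1 E2\<close> of the square
  matrix \<open>X\<close>.
\<close>

lemma full_rank_annihilator_unique:
  fixes Z B1 B2 :: "'a :: field mat"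
  assumes Z: "Z \<in> carrier_mat (n + k) k" and Y: "Y \<in> carrier_mat k (n + k)" and YZ: "Y * Z = 1\<^sub>m k"
    and B1: "B1 \<in> carrier_mat n (n + k)" "vec_space.rank n B1 = n" "B1 * Z = 0\<^sub>m n k"
    and B2: "B2 \<in> carrier_mat n (n + k)" "vec_space.rank n B2 = n" "B2 * Z = 0\<^sub>m n k"
  shows "\<exists>X \<in> carrier_mat n n. invertible_mat X \<and> B2 = X * B1"
proof -
  obtain E1 where E1: "E1 \<in> carrier_mat (n + k) n" "B1 * E1 = 1\<^sub>m n"
    using vec_space.rank_full_rows_imp_right_inverse[OF B1(1,2)] .
  obtain E2 where E2: "E2 \<in> carrier_mat (n + k) n" "B2 * E2 = 1\<^sub>m n"
    using vec_space.rank_full_rows_imp_right_inverse[OF B2(1,2)] .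
  let ?X = "B2 * E1"
  have X: "?X \<in> carrier_mat n n" using B2 E1 by auto
  have eq: "B2 = ?X * B1"
    by (rule full_rank_annihilator_factors[OF Z Y YZ B1(1) E1 B1(3) B2(1,3)])
  have "?X * (B1 * E2) = ?X * B1 * E2" using assoc_mult_mat[OF X B1(1) E2(1)] by simp
  also have "\<dots> = 1\<^sub>m n" using eq E2 by simp
  finally have "invertible_mat ?X"
    by (intro invertible_if_right_inverse[OF X, of "B1 * E2"]) (use B1 E2 in auto)
  with X eq show ?thesis by blast
qed

section \<open>Inverses and annihilators of a sheared block column\<close>

lemma mult_sheared:
  fixes P A M C :: "'a :: field mat"
  assumes P: "P \<in> carrier_mat r n" and A: "A \<in> carrier_mat n k"
    and M: "M \<in> carrier_mat n k" and C: "C \<in> carrier_mat k k"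
  shows "P * (A - M * C) = P * A - P * M * C"
  using mult_minus_distrib_mat[OF P A, of "M * C"] assoc_mult_mat[OF P M C] M C by simp

lemma sheared_left_inverse:
  fixes L A M C :: "'a :: field mat"
  assumes L: "L \<in> carrier_mat k n" and A: "A \<in> carrier_mat n k"
    and M: "M \<in> carrier_mat n k" and C: "C \<in> carrier_mat k k" and LA: "L * A = 1\<^sub>m k"
  shows "(L @\<^sub>c (L * M)) * ((A - M * C) @\<^sub>r C) = 1\<^sub>m k"
proof -
  have "(L @\<^sub>c (L * M)) * ((A - M * C) @\<^sub>r C) = L * (A - M * C) + L * M * C"
    by (rule append_cols_mult_append_rows[OF L]) (use A M C L in auto)
  also have "\<dots> = 1\<^sub>m k"
    unfolding mult_sheared[OF L A M C] LA using L M C by (intro eq_matI) auto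
  finally show ?thesis .
qed

lemma sheared_block_rows:
  fixes H D M :: "'a :: field mat"
  assumes H: "H \<in> carrier_mat l n" and D: "D \<in> carrier_mat k n" and M: "M \<in> carrier_mat n k"
  shows "H @\<^sub>c (H * M) \<in> carrier_mat l (n + k)"
  "- D @\<^sub>c (1\<^sub>m k - D * M) \<in> carrier_mat k (n + k)"
proof -
  show "H @\<^sub>c (H * M) \<in> carrier_mat l (n + k)"
    using carrier_append_cols[OF H mult_carrier_mat[OF H M]] .
  have "1\<^sub>m k - D * M \<in> carrier_mat k k"
    by (rule minus_carrier_mat[OF mult_carrier_mat[OF D M]])
  then show "- D @\<^sub>c (1\<^sub>m k - D * M) \<in> carrier_mat k (n + k)"
    using carrier_append_cols[OF uminus_carrier_mat[OF D]] by blast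
qed

text \<open>
  Before the shear, \<open>A\<close> stacked on \<open>C\<close> is annihilated by \<open>(H, 0)\<close> because \<open>H A = 0\<close>, and by
  \<open>(- D, 1)\<close> because \<open>D A = C\<close>. Composing these rows with the inverse shear adds the left block
  times \<open>M\<close> to the right block.
\<close>

lemma sheared_annihilator:
  fixes A M C H D :: "'a :: field mat"
  assumes A: "A \<in> carrier_mat n k" and M: "M \<in> carrier_mat n k" and C: "C \<in> carrier_mat k k"
    and H: "H \<in> carrier_mat l n" and D: "D \<in> carrier_mat k n"
    and HA: "H * A = 0\<^sub>m l k" and DA: "D * A = C"
  shows "((H @\<^sub>c (H * M)) @\<^sub>r (- D @\<^sub>c (1\<^sub>m k - D * M))) * ((A - M * C) @\<^sub>r C) = 0\<^sub>m (l + k) k"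
proof -
  have Z: "(A - M * C) @\<^sub>r C \<in> carrier_mat (n + k) k"
    by (rule carrier_append_rows) (use A M C in auto)
  have "(H @\<^sub>c (H * M)) * ((A - M * C) @\<^sub>r C) = H * (A - M * C) + H * M * C"
    by (rule append_cols_mult_append_rows[OF H]) (use A M C H in auto)
  also have "\<dots> = 0\<^sub>m l k"
    unfolding mult_sheared[OF H A M C] HA using H M C by (intro eq_matI) auto
  finally have 1: "(H @\<^sub>c (H * M)) * ((A - M * C) @\<^sub>r C) = 0\<^sub>m l k" .
  have a: "- D * (A - M * C) = - (C - D * M * C)"
    using mult_sheared[OF D A M C] uminus_mult_left_mat[of D "A - M * C"] DA D M C by simp
  have b: "(1\<^sub>m k - D * M) * C = C - D * M * C"
    using minus_mult_distrib_mat[OF one_carrier_mat _ C, of "D * M"] D M C by simp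
  have "(- D @\<^sub>c (1\<^sub>m k - D * M)) * ((A - M * C) @\<^sub>r C)
      = - D * (A - M * C) + (1\<^sub>m k - D * M) * C"
    by (rule append_cols_mult_append_rows[of _ k n _ k]) (use A M C D in auto)
  also have "\<dots> = 0\<^sub>m k k"
    unfolding a b using D M C by (intro eq_matI) auto
  finally have 2: "(- D @\<^sub>c (1\<^sub>m k - D * M)) * ((A - M * C) @\<^sub>r C) = 0\<^sub>m k k" .
  show ?thesis by (simp only: append_rows_mult[OF sheared_block_rows[OF H D M] Z] 1 2 zero_append_rows)
qed

text \<open>
  Before the shear the rows are \<open>(H, 0)\<close> and \<open>(- D, 1)\<close>, with the obvious right inverse built from
  \<open>U\<close> and \<open>1\<close>; the block \<open>- M\<close> comes from applying the shear to it.
\<close>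

lemma sheared_annihilator_right_inverse:
  fixes M H D U :: "'a :: field mat"
  assumes M: "M \<in> carrier_mat n k" and U: "U \<in> carrier_mat n l"
    and H: "H \<in> carrier_mat l n" and D: "D \<in> carrier_mat k n"
    and HU: "H * U = 1\<^sub>m l" and DU: "D * U = 0\<^sub>m k l"
  shows "((H @\<^sub>c (H * M)) @\<^sub>r (- D @\<^sub>c (1\<^sub>m k - D * M))) * ((U @\<^sub>r 0\<^sub>m k l) @\<^sub>c (- M @\<^sub>r 1\<^sub>m k))
    = 1\<^sub>m (l + k)"
proof -
  let ?E1 = "U @\<^sub>r 0\<^sub>m k l" and ?E2 = "- M @\<^sub>r 1\<^sub>m k"
  let ?R1 = "H @\<^sub>c (H * M)" and ?R2 = "- D @\<^sub>c (1\<^sub>m k - D * M)"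
  note R = sheared_block_rows[OF H D M]
  have E1: "?E1 \<in> carrier_mat (n + k) l" and E2: "?E2 \<in> carrier_mat (n + k) k"
    using U M by auto
  have "?R1 * ?E1 = H * U + H * M * 0\<^sub>m k l"
    by (rule append_cols_mult_append_rows[OF H]) (use U M H in auto)
  then have 11: "?R1 * ?E1 = 1\<^sub>m l" using HU H M by simp
  have "?R1 * ?E2 = H * (- M) + H * M * 1\<^sub>m k"
    by (rule append_cols_mult_append_rows[OF H]) (use M H in auto)
  then have 12: "?R1 * ?E2 = 0\<^sub>m l k"
    using H M by simp
  have "?R2 * ?E1 = - D * U + (1\<^sub>m k - D * M) * 0\<^sub>m k l"
    by (rule append_cols_mult_append_rows[of _ k n _ k]) (use U M D in auto)
  then have 21: "?R2 * ?E1 = 0\<^sub>m k l"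
    using DU D U M by (auto intro!: eq_matI)
  have "?R2 * ?E2 = - D * (- M) + (1\<^sub>m k - D * M) * 1\<^sub>m k"
    by (rule append_cols_mult_append_rows[of _ k n _ k]) (use M D in auto)
  also have "\<dots> = D * M + (1\<^sub>m k - D * M)" using D M by simp
  also have "\<dots> = 1\<^sub>m k"
    using D M by (intro eq_matI) auto
  finally have 22: "?R2 * ?E2 = 1\<^sub>m k" .
  have "(?R1 @\<^sub>r ?R2) * (?E1 @\<^sub>c ?E2) = (?R1 * (?E1 @\<^sub>c ?E2)) @\<^sub>r (?R2 * (?E1 @\<^sub>c ?E2))"
    by (rule append_rows_mult[OF R carrier_append_cols[OF E1 E2]])
  also have "\<dots> = 1\<^sub>m (l + k)"
    by (simp only: mult_append_cols[OF R(1) E1 E2] mult_append_cols[OF R(2) E1 E2] 11 12 21 22 one_mat_blocks)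
  finally show ?thesis .
qed

section \<open>Existence and uniqueness of the boundary matrix\<close>

theorem mainTheorem3:
  fixes n l :: nat
    and F T R_U R_S B_hat C Z :: "real mat"
    and lam :: "nat \<Rightarrow> real"
  assumes "l < n"
    and "F \<in> carrier_mat n n" and "invertible_mat F"
    and "T \<in> carrier_mat n n" and "invertible_mat T"
    and "mat_inv T * F * T = mat_diag n lam"
    and "\<And>i. i < l \<Longrightarrow> lam i > 0"
    and "\<And>i. l \<le> i \<Longrightarrow> i < n \<Longrightarrow> lam i < 0"
    and "R_U \<in> carrier_mat n l" and "R_S \<in> carrier_mat n (n - l)"
    and "T = R_U @\<^sub>c R_S"
    and "B_hat \<in> carrier_mat l n" and "invertible_mat (B_hat * R_U)"
    and "C \<in> carrier_mat (n - l) (n - l)"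
    and "Z = (- (R_U * mat_inv (B_hat * R_U) * B_hat * R_S) + R_S - mat_inv F * R_S * C) @\<^sub>r C"
  shows "(Z \<in> carrier_mat (2 * n - l) (n - l) \<and> vec_space.rank (2 * n - l) Z = n - l)
    \<and> (\<exists>B_bar \<in> carrier_mat n (2 * n - l).
           vec_space.rank n B_bar = n \<and> B_bar * Z = 0\<^sub>m n (n - l) \<and>
           (\<exists>B_u \<in> carrier_mat n n. \<exists>B_p \<in> carrier_mat n n. B_bar = B_u @\<^sub>c (B_p * R_S)))
    \<and> (\<forall>B1 \<in> carrier_mat n (2 * n - l). \<forall>B2 \<in> carrier_mat n (2 * n - l).
           vec_space.rank n B1 = n \<and> B1 * Z = 0\<^sub>m n (n - l) \<and>
           vec_space.rank n B2 = n \<and> B2 * Z = 0\<^sub>m n (n - l) \<longrightarrow>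
           (\<exists>X \<in> carrier_mat n n. invertible_mat X \<and> B2 = X * B1))"
proof -
  define k where "k = n - l"
  have dims: "2 * n - l = n + k" "n - l = k" "l + k = n" using assms(1) by (auto simp: k_def)
  note RU = assms(9) and Bh = assms(12)
  have RS: "R_S \<in> carrier_mat n k" and C: "C \<in> carrier_mat k k"
    using assms(10,14) dims by auto
  define G where "G = mat_inv (B_hat * R_U)"
  define H where "H = G * B_hat"
  define L where "L = (0\<^sub>m k l @\<^sub>c 1\<^sub>m k) * mat_inv T"
  define M where "M = mat_inv F * R_S"
  define A where "A = - (R_U * H * R_S) + R_S"
  have BRU: "B_hat * R_U \<in> carrier_mat l l" using Bh RU by auto
  note G = mat_inv_invertible[OF BRU assms(13), folded G_def]
  note Ti = mat_inv_invertible[OF assms(4,5)]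
  have M: "M \<in> carrier_mat n k"
    unfolding M_def using mat_inv_invertible(1)[OF assms(2,3)] RS by auto
  have H: "H \<in> carrier_mat l n" unfolding H_def using G Bh by auto
  have HU: "H * R_U = 1\<^sub>m l"
    unfolding H_def using assoc_mult_mat[OF G(1) Bh RU] G(3) by simp
  have S: "(0\<^sub>m k l @\<^sub>c 1\<^sub>m k :: real mat) \<in> carrier_mat k n"
    using carrier_append_cols[of "0\<^sub>m k l :: real mat" k l "1\<^sub>m k" k] dims by simp
  have L: "L \<in> carrier_mat k n" unfolding L_def using S Ti by auto
  \<comment> \<open>The lower block row of \<open>T^{-1} T = 1\<close>, compared block by block.\<close>
  have "L * T = 0\<^sub>m k l @\<^sub>c 1\<^sub>m k"
    unfolding L_def using assoc_mult_mat[OF S Ti(1) assms(4)] Ti(3) S by simp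
  then have "(L * R_U) @\<^sub>c (L * R_S) = 0\<^sub>m k l @\<^sub>c 1\<^sub>m k"
    using mult_append_cols[OF L RU RS] assms(11) by simp
  from append_cols_inject[OF _ _ _ _ this, of k l k]
  have LU: "L * R_U = 0\<^sub>m k l" and LS: "L * R_S = 1\<^sub>m k" using L RU RS by auto
  have A: "A \<in> carrier_mat n k" unfolding A_def using RU H RS by auto
  have URS: "R_U * H * R_S = R_U * (H * R_S)" by (rule assoc_mult_mat[OF RU H RS])
  have PA: "P * A = - (P * R_U * (H * R_S)) + P * R_S" if P: "P \<in> carrier_mat r n" for P r
  proof -
    have "P * A = P * (- (R_U * (H * R_S))) + P * R_S"
      unfolding A_def URS by (rule mult_add_distrib_mat[OF P]) (use RU H RS in auto)
    also have "P * (- (R_U * (H * R_S))) = - (P * (R_U * (H * R_S)))"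
      using P RU H RS by (simp add: uminus_mult_right_mat)
    also have "P * (R_U * (H * R_S)) = P * R_U * (H * R_S)"
      using assoc_mult_mat[OF P RU, of "H * R_S" k] H RS by simp
    finally show ?thesis .
  qed
  have HA: "H * A = 0\<^sub>m l k"
    unfolding PA[OF H] HU using H RS by (intro eq_matI) auto
  have LA: "L * A = 1\<^sub>m k"
    unfolding PA[OF L] LU LS using H RS by (intro eq_matI) auto
  have "R_U * G * B_hat = R_U * H"
    unfolding H_def by (rule assoc_mult_mat[OF RU G(1) Bh])
  then have Z_eq: "Z = (A - M * C) @\<^sub>r C"
    using assms(15) unfolding A_def M_def G_def by simp
  have Z: "Z \<in> carrier_mat (n + k) k"
    unfolding Z_eq by (rule carrier_append_rows) (use A M C in auto)

  define D where "D = C * L"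
  have D: "D \<in> carrier_mat k n" unfolding D_def using C L by auto
  have DA: "D * A = C" and DU: "D * R_U = 0\<^sub>m k l"
    unfolding D_def using assoc_mult_mat[OF C L A] assoc_mult_mat[OF C L RU] LA LU C by auto

  define Y where "Y = L @\<^sub>c (L * M)"
  have Y: "Y \<in> carrier_mat k (n + k)" unfolding Y_def using L M by auto
  have YZ: "Y * Z = 1\<^sub>m k" unfolding Y_def Z_eq by (rule sheared_left_inverse[OF L A M C LA])

  define B_u where "B_u = H @\<^sub>r - D"
  define N where "N = (H * M) @\<^sub>r (1\<^sub>m k - D * M)"
  define B_bar where "B_bar = B_u @\<^sub>c N"
  define E where "E = (R_U @\<^sub>r 0\<^sub>m k l) @\<^sub>c (- M @\<^sub>r 1\<^sub>m k)"
  have B_u: "B_u \<in> carrier_mat n n"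
    using carrier_append_rows[of H l n "- D" k] H D dims unfolding B_u_def by simp
  have N: "N \<in> carrier_mat n k"
    unfolding N_def dims(3)[symmetric] by (rule carrier_append_rows) (use H D M in auto)
  have B_bar: "B_bar \<in> carrier_mat n (n + k)" unfolding B_bar_def using B_u N by auto
  have E: "E \<in> carrier_mat (n + k) n"
    using carrier_append_cols[of "R_U @\<^sub>r 0\<^sub>m k l" "n + k" l "- M @\<^sub>r 1\<^sub>m k" k] RU M dims
    unfolding E_def by auto
  have B_bar_eq: "B_bar = (H @\<^sub>c (H * M)) @\<^sub>r (- D @\<^sub>c (1\<^sub>m k - D * M))"
    unfolding B_bar_def B_u_def N_def
    by (rule append_rows_append_cols_interchange[symmetric]) (use H D M in auto)
  have "B_bar * E = 1\<^sub>m n"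
    using sheared_annihilator_right_inverse[OF M RU H D HU DU] dims unfolding B_bar_eq E_def by simp
  then have B_bar_rank: "vec_space.rank n B_bar = n"
    by (rule vec_space.rank_eq_if_right_inverse[OF B_bar E])
  have B_bar_Z: "B_bar * Z = 0\<^sub>m n k"
    using sheared_annihilator[OF A M C H D HA DA] dims unfolding B_bar_eq Z_eq by simp
  have NL: "N * L \<in> carrier_mat n n" using N L by auto
  \<comment> \<open>\<open>L\<close> is a left inverse of \<open>R_S\<close>, so every \<open>n \<times> k\<close> matrix \<open>N\<close> has the form \<open>B_p R_S\<close>.\<close>
  have "N * L * R_S = N" using assoc_mult_mat[OF N L RS] LS N by simp
  then have split: "B_bar = B_u @\<^sub>c (N * L * R_S)" unfolding B_bar_def by simp

  show ?thesis
    unfolding dims(1,2)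
  proof (intro conjI ballI impI)
    show "Z \<in> carrier_mat (n + k) k" "vec_space.rank (n + k) Z = k"
      using Z vec_space.rank_eq_if_left_inverse[OF Z Y YZ] by auto
    show "\<exists>B_bar \<in> carrier_mat n (n + k). vec_space.rank n B_bar = n \<and> B_bar * Z = 0\<^sub>m n k \<and>
        (\<exists>B_u \<in> carrier_mat n n. \<exists>B_p \<in> carrier_mat n n. B_bar = B_u @\<^sub>c (B_p * R_S))"
      by (intro bexI[OF _ B_bar] conjI B_bar_rank B_bar_Z bexI[OF _ B_u] bexI[OF _ NL] split)
  next
    fix B1 B2 :: "real mat"
    assume "B1 \<in> carrier_mat n (n + k)" "B2 \<in> carrier_mat n (n + k)"
      and "vec_space.rank n B1 = n \<and> B1 * Z = 0\<^sub>m n k \<and>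
        vec_space.rank n B2 = n \<and> B2 * Z = 0\<^sub>m n k"
    then show "\<exists>X \<in> carrier_mat n n. invertible_mat X \<and> B2 = X * B1"
      by (intro full_rank_annihilator_unique[OF Z Y YZ]) auto
  qed
qed

end
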